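(* Let $a,b,c\in\mathbb{H}$ with $M=\max\{|a|,|b|,|c|\}>0$, and suppose $|a|,|b|,|c|$ do not form a triangle, i.e. the largest of them is at least the sum of the other two. Then \[m_{\mathbb{H}}(ax+by+c)=\log M+\frac{|a|^2+|b|^2+|c|^2}{4M^2}-\frac14.\]
   Context: $\mathbb{H}$ denotes the quaternions, $\mathbb{T}^2(\mathbb{H})=\{(x,y)\in\mathbb{H}^2:|x|=|y|=1\}$ with probability Haar measure $\mu$, and $m_{\mathbb{H}}(P)=\int_{\mathbb{T}^2(\mathbb{H})}\log|P(x,y)|\,d\mu$; here $ax+by+c$ is the function $(x,y)\mapsto ax+by+c$ with quaternion multiplication. *)

theory Defs
  imports "HOL-Analysis.Analysis" "HOL-Probability.Probability"
begin

text \<open>Quaternions are modelled as vectors in real^4; component 1 is the real part,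
  components 2,3,4 are the i, j, k parts. The Euclidean norm is the quaternion modulus.\<close>

type_synonym quat = "real ^ 4"

definition qmult :: "quat \<Rightarrow> quat \<Rightarrow> quat" where
  "qmult p q = (\<chi> n.
     if n = 1 then p$1*q$1 - p$2*q$2 - p$3*q$3 - p$4*q$4
     else if n = 2 then p$1*q$2 + p$2*q$1 + p$3*q$4 - p$4*q$3
     else if n = 3 then p$1*q$3 - p$2*q$4 + p$3*q$1 + p$4*q$2
     else p$1*q$4 + p$2*q$3 - p$3*q$2 + p$4*q$1)"

text \<open>Normalised Haar (= normalised surface) probability measure on the unit quaternions
  S^3: the push-forward of the uniform distribution on the unit ball under radial
  projection x \<mapsto> x/|x|.\<close>

definition sphere_haar :: "quat measure" where
  "sphere_haar = distr (uniform_measure lborel (ball 0 1)) borel (\<lambda>x. x /\<^sub>R norm x)"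

definition torus_haar :: "(quat \<times> quat) measure" where
  "torus_haar = sphere_haar \<Otimes>\<^sub>M sphere_haar"

definition mahler_H :: "(quat \<Rightarrow> quat \<Rightarrow> quat) \<Rightarrow> real" where
  "mahler_H P = (\<integral>z. ln (norm (P (fst z) (snd z))) \<partial>torus_haar)"

end

theory Submission
  imports Defs
begin

text \<open>Rotation invariance of the measure on \<open>S\<^sup>3\<close> reduces every average of
  \<open>g(|qu + p|\<^sup>2)\<close> over a unit quaternion \<open>u\<close> to the law of the first coordinate \<open>u\<^sub>1 = cos t\<close>,
  against which \<open>cos (n t)\<close> averages to \<open>1\<close> for \<open>n = 0\<close>, to \<open>-1/2\<close> for \<open>n = 2\<close> and to \<open>0\<close> otherwise.
  The Fourier series of \<open>ln |1 + r exp(it)|\<close> and of the Poisson kernel then show that \<open>ln |qu + p|\<close>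
  averages to \<open>ln A + B\<^sup>2 / (4A\<^sup>2)\<close>, where \<open>A \<ge> B\<close> are \<open>|q|\<close> and \<open>|p|\<close> in decreasing order, and that
  \<open>|qu + p|\<^sup>-\<^sup>2\<close> averages to \<open>|p|\<^sup>-\<^sup>2\<close> if \<open>|q| < |p|\<close>. If \<open>|b|\<close> dominates, average first over \<open>y\<close>
  and then \<open>|ax + c|\<^sup>2\<close> over \<open>x\<close>; if \<open>|c|\<close> dominates, the second average is that of
  \<open>ln |ax + c| + |b|\<^sup>2 / (4|ax + c|\<^sup>2)\<close>.\<close>

subsection \<open>Rotation invariance\<close>

text \<open>Inside the ball the preimage of a set under \<open>f\<close> is its image under the
  orthogonal map \<open>inv f\<close>, which preserves both the ball and Lebesgue measure.\<close>

lemma distr_uniform_ball_orthogonal: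
  fixes f :: "real^'n::{finite,wellorder} \<Rightarrow> real^'n::{finite,wellorder}"
  assumes f: "orthogonal_transformation f"
  shows "distr (uniform_measure lborel (ball 0 r)) borel f = uniform_measure lborel (ball 0 r)"
proof (rule measure_eqI)
  have lin: "linear f" "linear (inv f)"
    using f orthogonal_transformation_inv[OF f] by (auto intro: orthogonal_transformation_linear)
  have [measurable]: "f \<in> borel_measurable borel"
    by (intro borel_measurable_continuous_onI linear_continuous_on)
       (use lin(1) in \<open>simp add: linear_conv_bounded_linear\<close>)
  fix A assume "A \<in> sets (distr (uniform_measure lborel (ball 0 r)) borel f)"
  then have A[measurable]: "A \<in> sets borel" by simp
  have pre: "f -` A \<in> sets borel"
    using measurable_sets[of f borel borel A] by simp
  have eq: "ball 0 r \<inter> f -` A = inv f ` (ball 0 r \<inter> A)"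
    using bij_vimage_eq_inv_image[OF orthogonal_transformation_bij[OF f], of "ball 0 r \<inter> A"]
    by (auto simp: orthogonal_transformation_norm[OF f] set_eq_iff)
  have B: "ball 0 r \<inter> A \<in> lmeasurable"
    by (rule bounded_set_imp_lmeasurable) (auto intro: bounded_subset[OF bounded_ball])
  have "emeasure lborel (ball 0 r \<inter> f -` A) = emeasure lebesgue (inv f ` (ball 0 r \<inter> A))"
    using pre by (simp flip: eq)
  also have "\<dots> = emeasure lebesgue (ball 0 r \<inter> A)"
    using measurable_orthogonal_image[OF orthogonal_transformation_inv[OF f] B]
      measure_orthogonal_image[OF orthogonal_transformation_inv[OF f] B] B
    by (simp add: emeasure_eq_measure2)
  also have "\<dots> = emeasure lborel (ball 0 r \<inter> A)" by simp
  finally show "emeasure (distr (uniform_measure lborel (ball 0 r)) borel f) A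
      = emeasure (uniform_measure lborel (ball 0 r)) A"
    using pre by (simp add: emeasure_distr)
qed simp

lemma emeasure_lborel_unit_ball:
  "emeasure lborel (ball (0::'a::euclidean_space) 1) \<noteq> 0" "emeasure lborel (ball (0::'a) 1) \<noteq> \<infinity>"
  using content_ball_pos[of 1 "0::'a"] emeasure_lborel_ball_finite[of "0::'a" 1]
  by (auto simp: measure_def)

lemma sets_sphere_haar [measurable_cong, simp]: "sets sphere_haar = sets borel"
  and space_sphere_haar [simp]: "space sphere_haar = UNIV"
  by (simp_all add: sphere_haar_def)

interpretation sphere: prob_space sphere_haar
proof -
  interpret prob_space "uniform_measure lborel (ball (0::quat) 1)"
    by (intro prob_space_uniform_measure emeasure_lborel_unit_ball)
  show "prob_space sphere_haar"
    unfolding sphere_haar_def by (intro prob_space_distr) simp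
qed

text \<open>A linear isometry commutes with radial projection, so invariance passes from the ball to
  the sphere.\<close>

lemma distr_sphere_haar_orthogonal:
  fixes f :: "quat \<Rightarrow> quat"
  assumes f: "orthogonal_transformation f"
  shows "distr sphere_haar borel f = sphere_haar"
proof -
  have lin: "linear f" using f by (rule orthogonal_transformation_linear)
  have [measurable]: "f \<in> borel_measurable borel"
    by (intro borel_measurable_continuous_onI linear_continuous_on)
       (use lin in \<open>simp add: linear_conv_bounded_linear\<close>)
  have "distr sphere_haar borel f
      = distr (uniform_measure lborel (ball 0 1)) borel (\<lambda>x. f (x /\<^sub>R norm x))"
    unfolding sphere_haar_def by (subst distr_distr) (auto simp: o_def)
  also have "(\<lambda>x. f (x /\<^sub>R norm x)) = (\<lambda>x. x /\<^sub>R norm x) \<circ> f"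
    by (simp add: fun_eq_iff orthogonal_transformation_norm[OF f] linear_cmul[OF lin])
  also have "distr (uniform_measure lborel (ball 0 1)) borel \<dots>
      = distr (distr (uniform_measure lborel (ball 0 1)) borel f) borel (\<lambda>x. x /\<^sub>R norm x)"
    by (subst distr_distr) auto
  finally show ?thesis
    by (simp add: distr_uniform_ball_orthogonal[OF f] sphere_haar_def)
qed

lemma AE_sphere_haarI:
  assumes "{x::quat. Q x} \<in> sets borel" and "AE x in lborel. Q (x /\<^sub>R norm x)"
  shows "AE x in sphere_haar. Q x"
  unfolding sphere_haar_def using assms
  by (subst AE_distr_iff) (auto intro!: AE_uniform_measureI)

lemma AE_sphere_haar_norm: "AE u in sphere_haar. norm u = 1"
proof (rule AE_sphere_haarI)
  show "AE x in lborel. norm ((x::quat) /\<^sub>R norm x) = 1"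
    using AE_lborel_singleton[of "0::quat"] by eventually_elim simp
qed simp

text \<open>Points are null: apart from the origin, whatever projects radially to \<open>v\<close>
  lies on the line spanned by \<open>v\<close>, which is negligible in dimension 4.\<close>

lemma AE_sphere_haar_neq: "AE u in sphere_haar. u \<noteq> v"
proof (rule AE_sphere_haarI)
  have "negligible (span {v})"
    by (rule negligible_lowdim) (use dim_singleton[of v] in \<open>simp add: dim_span\<close>)
  then have "AE x in lebesgue. x \<notin> span {v}"
    by (simp add: negligible_iff_null_sets AE_not_in)
  then have "AE x in lborel. x \<notin> span {v}"
    by (simp add: AE_completion_iff)
  moreover have "AE x in lborel. x \<noteq> (0::quat)" by (rule AE_lborel_singleton)
  ultimately show "AE x in lborel. (x::quat) /\<^sub>R norm x \<noteq> v"
  proof eventually_elim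
    fix x assume x: "x \<notin> span {v}" "x \<noteq> (0::quat)"
    show "x /\<^sub>R norm x \<noteq> v"
    proof
      assume "x /\<^sub>R norm x = v"
      then have "x = norm x *\<^sub>R v" using x by auto
      then show False using x by (metis span_base span_scale insertI1)
    qed
  qed
qed auto

text \<open>Some orthogonal map sends \<open>norm w\<close> times the first basis vector to
  \<open>w\<close>, and invariance allows it as a change of variables. The equivalence transfers
  integrability together with the value, also for unbounded \<open>g\<close>.\<close>

lemma has_bochner_integral_sphere_inner:
  fixes w :: quat and g :: "real \<Rightarrow> real"
  assumes [measurable]: "g \<in> borel_measurable borel"
  shows "has_bochner_integral sphere_haar (\<lambda>u. g (w \<bullet> u)) v
    \<longleftrightarrow> has_bochner_integral sphere_haar (\<lambda>u. g (norm w * u$1)) v"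
proof -
  have "norm (norm w *\<^sub>R axis 1 1 :: quat) = norm w" by simp
  then obtain f :: "quat \<Rightarrow> quat"
    where f: "orthogonal_transformation f" "f (norm w *\<^sub>R axis 1 1) = w"
    by (rule orthogonal_transformation_exists)
  have lin: "linear f" using f(1) by (rule orthogonal_transformation_linear)
  have [measurable]: "f \<in> borel_measurable borel"
    by (intro borel_measurable_continuous_onI linear_continuous_on)
       (use lin in \<open>simp add: linear_conv_bounded_linear\<close>)
  have "w \<bullet> f u = norm w * u$1" for u
  proof -
    have "w \<bullet> f u = (norm w *\<^sub>R axis 1 1) \<bullet> u"
      using f orthogonal_transformation_def by metis
    then show ?thesis by (simp add: inner_axis')
  qed
  then have "has_bochner_integral sphere_haar (\<lambda>u. g (norm w * u$1)) v
    \<longleftrightarrow> has_bochner_integral sphere_haar (\<lambda>u. g (w \<bullet> f u)) v" by simp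
  also have "\<dots> \<longleftrightarrow> has_bochner_integral (distr sphere_haar borel f) (\<lambda>u. g (w \<bullet> u)) v"
    by (simp add: has_bochner_integral_iff integrable_distr_eq integral_distr)
  finally show ?thesis by (simp add: distr_sphere_haar_orthogonal[OF f(1)])
qed

subsection \<open>Moments of a coordinate and Chebyshev polynomials\<close>

lemma integrable_sphere_haar_continuous:
  fixes f :: "quat \<Rightarrow> real"
  assumes "continuous_on UNIV f"
  shows "integrable sphere_haar f"
proof -
  have [measurable]: "f \<in> borel_measurable borel"
    using assms by (rule borel_measurable_continuous_onI)
  have "bounded (f ` sphere 0 1)"
    by (intro compact_imp_bounded compact_continuous_image continuous_on_subset[OF assms]) auto
  then obtain B where B: "\<And>u. norm u = 1 \<Longrightarrow> norm (f u) \<le> B"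
    by (fastforce simp: bounded_iff)
  show ?thesis
  proof (rule sphere.integrable_const_bound[where B = B])
    show "AE u in sphere_haar. norm (f u) \<le> B"
      using AE_sphere_haar_norm by eventually_elim (rule B)
  qed simp
qed

lemma sphere_power_inner:
  fixes w :: quat
  shows "sphere.expectation (\<lambda>u. (w \<bullet> u) ^ n) = norm w ^ n * sphere.expectation (\<lambda>u. u$1 ^ n)"
proof -
  have "has_bochner_integral sphere_haar (\<lambda>u. (w \<bullet> u) ^ n) (sphere.expectation (\<lambda>u. (w \<bullet> u) ^ n))"
    by (intro has_bochner_integral_integrable integrable_sphere_haar_continuous continuous_intros)
  then have "has_bochner_integral sphere_haar (\<lambda>u. (norm w * u$1) ^ n)
      (sphere.expectation (\<lambda>u. (w \<bullet> u) ^ n))"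
    by (subst (asm) has_bochner_integral_sphere_inner[where g = "\<lambda>t. t ^ n"]) auto
  then show ?thesis
    by (simp add: has_bochner_integral_iff power_mult_distrib)
qed

text \<open>Reflection, here \<open>w = - axis 1 1\<close>, shows that the moment equals its own
  negative.\<close>

lemma sphere_odd_moment: "odd n \<Longrightarrow> sphere.expectation (\<lambda>u. u$1 ^ n) = 0"
  using sphere_power_inner[of "- axis 1 1" n] by (simp add: inner_axis')

lemma coeff_power_one_plus_square:
  "coeff ([:1, 0, 1::real:] ^ k) 0 = 1 \<and> coeff ([:1, 0, 1::real:] ^ k) 1 = 0
    \<and> coeff ([:1, 0, 1::real:] ^ k) 2 = real k"
  by (induction k) (auto simp: coeff_pCons numeral_2_eq_2 split: nat.splits)

text \<open>The average of \<open>(u\<^sub>1 + s u\<^sub>i)\<^sup>2\<^sup>k\<close> is a multiple of \<open>(1 + s\<^sup>2)\<^sup>k\<close> by rotation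
  invariance; the coefficients of \<open>s\<^sup>2\<close> are compared.\<close>

lemma sphere_mixed_moment:
  assumes i: "i \<noteq> 1"
  shows "(2 * real m + 1) * sphere.expectation (\<lambda>u. (u$i)\<^sup>2 * u$1 ^ (2 * m))
    = sphere.expectation (\<lambda>u. u$1 ^ (2 * m + 2))"
proof -
  define N where "N = 2 * m + 2"
  have "2 \<le> N" by (simp add: N_def)
  define M where "M = sphere.expectation (\<lambda>u. u$1 ^ N)"
  define e where "e j = sphere.expectation (\<lambda>u. u$i ^ j * u$1 ^ (N - j))" for j
  define p where "p = (\<Sum>j\<le>N. monom (real (N choose j) * e j) j)"
  define q where "q = smult M ([:1, 0, 1:] ^ (m + 1))"
  have "poly p s = poly q s" for s
  proof -
    define w :: quat where "w = axis 1 1 + s *\<^sub>R axis i 1"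
    have w: "w \<bullet> u = s * u$i + u$1" for u
      by (simp add: w_def inner_add_left inner_axis')
    have "(norm w)\<^sup>2 = 1 + s\<^sup>2"
      unfolding power2_norm_eq_inner w using i by (simp add: w_def axis_def power2_eq_square)
    then have nw: "norm w ^ N = (1 + s\<^sup>2) ^ (m + 1)"
      by (metis N_def distrib_left mult.right_neutral nat_mult_1_right power_mult)
    have "poly p s = (\<Sum>j\<le>N. sphere.expectation (\<lambda>u. real (N choose j) * (s * u$i) ^ j * u$1 ^ (N - j)))"
      by (auto simp: p_def poly_sum poly_monom e_def power_mult_distrib mult_ac intro!: sum.cong
               simp flip: Bochner_Integration.integral_mult_right_zero)
    also have "\<dots> = sphere.expectation (\<lambda>u. \<Sum>j\<le>N. real (N choose j) * (s * u$i) ^ j * u$1 ^ (N - j))"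
      by (intro Bochner_Integration.integral_sum[symmetric] integrable_sphere_haar_continuous
          continuous_intros)
    also have "\<dots> = sphere.expectation (\<lambda>u. (w \<bullet> u) ^ N)"
      by (simp add: w binomial_ring)
    also have "\<dots> = (1 + s\<^sup>2) ^ (m + 1) * M"
      by (simp only: sphere_power_inner nw M_def)
    also have "\<dots> = poly q s"
      unfolding q_def poly_smult poly_power by (simp add: power2_eq_square)
    finally show ?thesis .
  qed
  then have "p = q" by (simp add: poly_eq_poly_eq_iff[symmetric] fun_eq_iff)
  then have "coeff p 2 = coeff q 2" by simp
  moreover have "coeff p 2 = real (N choose 2) * e 2"
    using \<open>2 \<le> N\<close> by (simp add: p_def coeff_sum)
  moreover have "coeff q 2 = M * (real m + 1)"
    using coeff_power_one_plus_square[of "m + 1"] by (simp add: q_def)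
  \<comment> \<open>The factor \<open>m + 1\<close> occurs in this binomial coefficient and in the
    coefficient of \<open>q\<close>, so it cancels below.\<close>
  moreover have "real (N choose 2) = (real m + 1) * (2 * real m + 1)"
  proof -
    have "N choose 2 = (m + 1) * (2 * m + 1)" by (simp add: N_def choose_two)
    then show ?thesis by (simp add: algebra_simps)
  qed
  ultimately have "(real m + 1) * ((2 * real m + 1) * e 2) = (real m + 1) * M"
    by (simp add: mult_ac)
  then have "(2 * real m + 1) * e 2 = M" by (simp del: distrib_left_numeral)
  then show ?thesis by (simp add: e_def M_def N_def)
qed

text \<open>Multiply \<open>u$1 ^ (2 * m)\<close> by the sum of the four squared coordinates, which
  is 1. Each of the three mixed moments is the next even moment divided by \<open>2 * m + 1\<close>,
  whence the constant \<open>(2 * m + 1) + 3\<close>.\<close>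

lemma sphere_moment_rec:
  "(2 * real m + 4) * sphere.expectation (\<lambda>u. u$1 ^ (2 * m + 2))
    = (2 * real m + 1) * sphere.expectation (\<lambda>u. u$1 ^ (2 * m))"
proof -
  have "sphere.expectation (\<lambda>u. u$1 ^ (2 * m))
      = sphere.expectation (\<lambda>u. u$1 ^ (2 * m + 2) + (u$2)\<^sup>2 * u$1 ^ (2 * m)
          + (u$3)\<^sup>2 * u$1 ^ (2 * m) + (u$4)\<^sup>2 * u$1 ^ (2 * m))"
  proof (rule integral_cong_AE)
    show "AE u in sphere_haar. u$1 ^ (2 * m) = u$1 ^ (2 * m + 2) + (u$2)\<^sup>2 * u$1 ^ (2 * m)
          + (u$3)\<^sup>2 * u$1 ^ (2 * m) + (u$4)\<^sup>2 * u$1 ^ (2 * m)"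
      using AE_sphere_haar_norm
    proof eventually_elim
      fix u :: quat assume "norm u = 1"
      then have "u \<bullet> u = 1" by (simp add: norm_eq_1)
      then have "(u$1)\<^sup>2 + (u$2)\<^sup>2 + (u$3)\<^sup>2 + (u$4)\<^sup>2 = 1"
        by (simp add: inner_vec_def sum_4 power2_eq_square)
      then have "u$1 ^ (2 * m) = ((u$1)\<^sup>2 + (u$2)\<^sup>2 + (u$3)\<^sup>2 + (u$4)\<^sup>2) * u$1 ^ (2 * m)" by simp
      then show "u$1 ^ (2 * m) = u$1 ^ (2 * m + 2) + (u$2)\<^sup>2 * u$1 ^ (2 * m)
          + (u$3)\<^sup>2 * u$1 ^ (2 * m) + (u$4)\<^sup>2 * u$1 ^ (2 * m)"
        by (simp add: algebra_simps power2_eq_square)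
    qed
  qed measurable
  also have "\<dots> = sphere.expectation (\<lambda>u. u$1 ^ (2 * m + 2))
      + sphere.expectation (\<lambda>u. (u$2)\<^sup>2 * u$1 ^ (2 * m))
      + sphere.expectation (\<lambda>u. (u$3)\<^sup>2 * u$1 ^ (2 * m))
      + sphere.expectation (\<lambda>u. (u$4)\<^sup>2 * u$1 ^ (2 * m))"
  proof -
    have 1: "integrable sphere_haar (\<lambda>u. u$1 ^ (2 * m + 2))"
      by (intro integrable_sphere_haar_continuous continuous_intros)
    have 2: "integrable sphere_haar (\<lambda>u. (u$i)\<^sup>2 * u$1 ^ (2 * m))" for i
      by (intro integrable_sphere_haar_continuous continuous_intros)
    from 1 2 show ?thesis by simp
  qed
  finally show ?thesis
    using sphere_mixed_moment[of 2 m] sphere_mixed_moment[of 3 m] sphere_mixed_moment[of 4 m]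
    by (simp add: algebra_simps)
qed

section \<open>The averaging functional on polynomials in the first coordinate\<close>

definition sphere_poly :: "real poly \<Rightarrow> real" where
  "sphere_poly p = sphere.expectation (\<lambda>u. poly p (u$1))"

lemma integrable_sphere_poly: "integrable sphere_haar (\<lambda>u. poly p (u$1))"
  by (intro integrable_sphere_haar_continuous continuous_intros)

lemma sphere_poly_simps [simp]:
  "sphere_poly 0 = 0" "sphere_poly 1 = 1"
  "sphere_poly (p + q) = sphere_poly p + sphere_poly q"
  "sphere_poly (p - q) = sphere_poly p - sphere_poly q"
  "sphere_poly (smult c p) = c * sphere_poly p"
  using sphere.prob_space by (simp_all add: sphere_poly_def integrable_sphere_poly)

lemma sphere_poly_sum: "sphere_poly (sum f A) = (\<Sum>i\<in>A. sphere_poly (f i))"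
  by (induction A rule: infinite_finite_induct) simp_all

text \<open>Integration by parts against the density \<open>(1 - t\<^sup>2)\<^sup>1\<^sup>/\<^sup>2\<close> of \<open>u\<^sub>1\<close>, obtained from the moments.\<close>

lemma sphere_poly_parts: "sphere_poly ([:0, 3:] * p - [:1, 0, -1:] * pderiv p) = 0"
proof -
  \<comment> \<open>With \<open>w = (1 - t^2)^(1/2)\<close>, \<open>D p\<close> is the negative
    derivative of \<open>w^3 * p\<close> divided by \<open>w\<close>. By linearity it is enough to
    treat monomials.\<close>
  define D where "D p = [:0, 3:] * p - [:1, 0, -1:] * pderiv p" for p :: "real poly"
  have D_sum: "D (sum f A) = (\<Sum>i\<in>A. D (f i))" for f :: "nat \<Rightarrow> real poly" and A
  proof -
    have "D (p + q) = D p + D q" for p q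
      unfolding D_def pderiv_add by (simp only: algebra_simps)
    moreover have "D 0 = 0" by (simp add: D_def)
    ultimately show ?thesis by (induction A rule: infinite_finite_induct) simp_all
  qed
  have *: "sphere_poly (D (monom c n)) = 0" for c n
  proof (cases n)
    case 0
    have "sphere_poly (D (monom c n)) = sphere.expectation (\<lambda>u. 3 * c * u$1 ^ 1)"
      unfolding sphere_poly_def 0 by (simp add: D_def monom_0 pderiv_pCons mult_ac)
    also have "\<dots> = 3 * c * sphere.expectation (\<lambda>u. u$1 ^ 1)" by simp
    finally show ?thesis using sphere_odd_moment[of 1] by simp
  next
    case (Suc k)
    have "sphere_poly (D (monom c n))
        = sphere.expectation (\<lambda>u. c * ((real k + 4) * u$1 ^ (k + 2) - (real k + 1) * u$1 ^ k))"
      unfolding sphere_poly_def Suc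
      by (intro Bochner_Integration.integral_cong)
         (simp_all add: D_def poly_monom pderiv_monom algebra_simps power2_eq_square)
    also have "\<dots> = c * ((real k + 4) * sphere.expectation (\<lambda>u. u$1 ^ (k + 2))
        - (real k + 1) * sphere.expectation (\<lambda>u. u$1 ^ k))"
    proof -
      have "integrable sphere_haar (\<lambda>u. u$1 ^ j)" for j
        by (intro integrable_sphere_haar_continuous continuous_intros)
      then show ?thesis by (simp del: power_add power_add_numeral2 power_Suc add_2_eq_Suc')
    qed
    also have "\<dots> = 0"
    \<comment> \<open>For even \<open>k\<close> the bracket is the moment recurrence; for odd
      \<open>k\<close> both moments vanish.\<close>
    proof (cases "even k")
      case True
      then obtain m where "k = 2 * m" by blast
      then show ?thesis using sphere_moment_rec[of m] by simp
    next
      case False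
      then show ?thesis using sphere_odd_moment[of k] sphere_odd_moment[of "k + 2"] by simp
    qed
    finally show ?thesis .
  qed
  have "sphere_poly (D (\<Sum>i\<le>degree p. monom (coeff p i) i)) = 0"
    by (simp add: D_sum sphere_poly_sum *)
  then show ?thesis by (simp add: poly_as_sum_of_monoms D_def)
qed

text \<open>\<open>chebT n\<close> is the Chebyshev polynomial of the first kind and \<open>chebV n\<close> the one
  of the second kind of index \<open>n - 1\<close>.\<close>

fun chebT chebV :: "nat \<Rightarrow> real poly" where
  "chebT 0 = 1"
| "chebT (Suc n) = [:0, 1:] * chebT n - [:1, 0, -1:] * chebV n"
| "chebV 0 = 0"
| "chebV (Suc n) = [:0, 1:] * chebV n + chebT n"

text \<open>The two recurrences are the addition theorems for \<open>cos\<close> and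
  \<open>sin\<close>, with the square of \<open>sin t\<close> written as
  \<open>1 - (cos t)^2\<close>.\<close>

lemma cheb_cos:
  "poly (chebT n) (cos t) = cos (real n * t) \<and> poly (chebV n) (cos t) * sin t = sin (real n * t)"
proof (induction n)
  case (Suc n)
  have 1: "1 - cos t * cos t = sin t * sin t"
    using sin_cos_squared_add[of t] by (simp add: power2_eq_square)
  have "poly (chebT (Suc n)) (cos t)
      = cos t * poly (chebT n) (cos t) - (1 - cos t * cos t) * poly (chebV n) (cos t)"
    by (simp add: algebra_simps)
  also have "\<dots> = cos t * poly (chebT n) (cos t) - sin t * (poly (chebV n) (cos t) * sin t)"
    by (simp add: 1)
  also have "\<dots> = cos (real (Suc n) * t)"
    using Suc by (simp add: algebra_simps cos_add)
  finally have A: "poly (chebT (Suc n)) (cos t) = cos (real (Suc n) * t)" .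
  have "poly (chebV (Suc n)) (cos t) * sin t
      = cos t * (poly (chebV n) (cos t) * sin t) + poly (chebT n) (cos t) * sin t"
    by (simp add: algebra_simps)
  also have "\<dots> = sin (real (Suc n) * t)"
    using Suc by (simp add: algebra_simps sin_add)
  finally show ?case using A by simp
qed simp

text \<open>Algebraic form of differentiating \<open>cos (n t)\<close> and
  \<open>sin (n t) / sin t\<close> in the variable \<open>cos t\<close>. The derivative of
  \<open>chebV n\<close> enters only with the factor \<open>1 - x^2\<close>, so a joint induction on
  both identities closes.\<close>

lemma pderiv_cheb:
  "pderiv (chebT n) = of_nat n * chebV n
    \<and> [:1, 0, -1:] * pderiv (chebV n) = [:0, 1:] * chebV n - of_nat n * chebT n"
proof (induction n)
  case (Suc n)
  let ?x = "[:0, 1:] :: real poly" and ?y = "[:1, 0, -1:] :: real poly"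
  have y: "?y = 1 - ?x * ?x" by (simp add: one_pCons)
  have dx: "pderiv ?x = 1" by (simp add: pderiv_pCons)
  have dy: "pderiv ?y = - 2 * ?x" by (simp add: pderiv_pCons numeral_poly)
  from Suc have a: "pderiv (chebT n) = of_nat n * chebV n"
    and b: "?y * pderiv (chebV n) = ?x * chebV n - of_nat n * chebT n" by auto
  have "pderiv (chebT (Suc n)) = chebT n + ?x * (of_nat n * chebV n)
      + 2 * ?x * chebV n - ?y * pderiv (chebV n)"
    by (simp only: chebT.simps pderiv_diff pderiv_mult dx dy a) (simp add: algebra_simps)
  also have "\<dots> = of_nat (Suc n) * chebV (Suc n)"
    unfolding b by (simp add: algebra_simps del: mult_pCons_left mult_pCons_right)
  finally have A: "pderiv (chebT (Suc n)) = of_nat (Suc n) * chebV (Suc n)" .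
  have "?y * pderiv (chebV (Suc n))
      = ?y * chebV n + ?x * (?y * pderiv (chebV n)) + ?y * (of_nat n * chebV n)"
    by (simp only: chebV.simps pderiv_add pderiv_mult dx a) (simp only: algebra_simps mult_1_left mult_1_right)
  also have "\<dots> = ?x * chebV (Suc n) - of_nat (Suc n) * chebT (Suc n)"
    unfolding b unfolding chebT.simps chebV.simps y
    by (simp add: algebra_simps del: mult_pCons_left mult_pCons_right)
  finally show ?case using A by simp
qed (simp add: one_pCons pderiv_pCons)

text \<open>This is the addition theorem for \<open>sin ((n + 1) t - t)\<close>, divided by
  \<open>sin t\<close>.\<close>

lemma chebV_pred: "chebV n = [:0, 1:] * chebV (Suc n) - chebT (Suc n)"
proof -
  have y: "[:1, 0, -1:] = 1 - [:0, 1:] * ([:0, 1:] :: real poly)" by (simp add: one_pCons)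
  show ?thesis unfolding chebT.simps chebV.simps y
    by (simp add: algebra_simps del: mult_pCons_left mult_pCons_right)
qed

declare chebT.simps(2) [simp del] chebV.simps(2) [simp del]

section \<open>Averages of Chebyshev polynomials\<close>

lemma sphere_chebV_add_diff:
  "sphere_poly (chebV (k + 2))
    = sphere_poly ([:0, 1:] * chebV (Suc k)) + sphere_poly (chebT (Suc k))"
  "sphere_poly (chebV k)
    = sphere_poly ([:0, 1:] * chebV (Suc k)) - sphere_poly (chebT (Suc k))"
proof -
  show "sphere_poly (chebV (k + 2))
      = sphere_poly ([:0, 1:] * chebV (Suc k)) + sphere_poly (chebT (Suc k))"
    by (simp only: add_2_eq_Suc' chebV.simps(2)[of "Suc k"] sphere_poly_simps)
  show "sphere_poly (chebV k)
      = sphere_poly ([:0, 1:] * chebV (Suc k)) - sphere_poly (chebT (Suc k))"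
    by (simp only: chebV_pred[of k] sphere_poly_simps)
qed

text \<open>Integration by parts is applied to \<open>chebV (Suc k)\<close>: the differential
  relation turns the integrand into \<open>2 x V + (k + 1) T\<close>. Half the sum and half the
  difference of the averages at \<open>k + 2\<close> and \<open>k\<close> are those of
  \<open>x V\<close> and \<open>T\<close>.\<close>

lemma sphere_chebV_rec:
  "(real k + 3) * sphere_poly (chebV (k + 2)) = (real k - 1) * sphere_poly (chebV k)"
proof -
  let ?V = "chebV (Suc k)" and ?T = "chebT (Suc k)" and ?x = "[:0, 1:] :: real poly"
  have e: "[:0, 3:] = ?x + ?x + ?x" "smult 2 p = p + p"
    "smult (real k + 1) p = of_nat (Suc k) * p" for p :: "real poly"
    using smult_add_left[of 1 1 p] by (simp_all add: of_nat_poly add.commute)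
  have "[:0, 3:] * ?V - [:1, 0, -1:] * pderiv ?V = smult 2 (?x * ?V) + smult (real k + 1) ?T"
    unfolding pderiv_cheb[of "Suc k", THEN conjunct2] e by (simp only: algebra_simps)
  then have "sphere_poly (smult 2 (?x * ?V) + smult (real k + 1) ?T) = 0"
    using sphere_poly_parts[of ?V] by (simp only:)
  then have eq: "2 * sphere_poly (?x * ?V) + (real k + 1) * sphere_poly ?T = 0"
    by (simp only: sphere_poly_simps)
  have "(r + 3) * (X + T) = (r - 1) * (X - T) + 2 * (2 * X + (r + 1) * T)" for r X T :: real
    by (simp add: algebra_simps)
  from this[of "real k" "sphere_poly (?x * ?V)" "sphere_poly ?T"] show ?thesis
    unfolding sphere_chebV_add_diff(1) sphere_chebV_add_diff(2)[of k] eq by (simp only: mult_zero_right add_0_right)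
qed

text \<open>Second-kind polynomials of positive degree are orthogonal to 1 for their own weight. In
  the descent by two the factor \<open>k - 1\<close> vanishes at \<open>k = 1\<close>, so the
  nonzero average of \<open>chebV 1 = 1\<close> does not reach \<open>chebV 3\<close>.\<close>

lemma sphere_chebV: "n \<noteq> 1 \<Longrightarrow> sphere_poly (chebV n) = 0"
proof (induction n rule: less_induct)
  case (less n)
  have "n = 0 \<or> n = 2 \<or> n = 3 \<or> n = (n - 2) + 2 \<and> n - 2 > 1"
    using less.prems by linarith
  then consider "n = 0" | "n = 2" | "n = 3" | k where "n = k + 2" "k > 1"
    by blast
  then show ?case
  proof cases
    case 2 then show ?thesis using sphere_chebV_rec[of 0] by (simp add: numeral_2_eq_2)
  next
    case 3 then show ?thesis using sphere_chebV_rec[of 1] by (simp add: numeral_3_eq_3)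
  next
    case (4 k) then show ?thesis using sphere_chebV_rec[of k] less.IH[of k] by simp
  qed simp
qed

text \<open>For \<open>n = k + 1\<close> the average is half the difference of those of
  \<open>chebV (k + 2)\<close> and \<open>chebV k\<close>. Only \<open>chebV 1\<close> contributes,
  which happens at \<open>k = 1\<close>.\<close>

lemma sphere_chebT: "sphere_poly (chebT n) = (if n = 0 then 1 else if n = 2 then - 1 / 2 else 0)"
proof (cases n)
  case (Suc k)
  have "2 * sphere_poly (chebT n) = sphere_poly (chebV (k + 2)) - sphere_poly (chebV k)"
    unfolding sphere_chebV_add_diff(1) sphere_chebV_add_diff(2)[of k] Suc by argo
  moreover have "sphere_poly (chebV 1) = 1"
    by (simp add: chebV.simps(2))
  moreover have "sphere_poly (chebV (k + 2)) = 0"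
    by (rule sphere_chebV) simp
  moreover have "k \<noteq> 1 \<Longrightarrow> sphere_poly (chebV k) = 0" by (rule sphere_chebV)
  ultimately show ?thesis by (cases "k = 1") (auto simp: Suc)
qed simp

subsection \<open>Averages of Fourier series in the first coordinate\<close>

text \<open>On the unit sphere the first coordinate is -1 only at a single point, a null set.
  Excluding it keeps the arguments of the logarithms positive up to \<open>r = 1\<close>.\<close>

lemma AE_sphere_haar_component: "AE u in sphere_haar. \<bar>u$1\<bar> \<le> 1 \<and> u$1 \<noteq> - 1"
  using AE_sphere_haar_norm AE_sphere_haar_neq[of "- axis 1 1"]
proof eventually_elim
  fix u :: quat assume u: "norm u = 1" "u \<noteq> - axis 1 1"
  have "u$1 \<noteq> - 1"
  proof
    assume "u$1 = - 1"
    then have "(norm (u + axis 1 1))\<^sup>2 = 0"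
      using u(1) by (simp add: power2_norm_eq_inner inner_add inner_axis inner_axis' norm_eq_1)
    then show False using u(2) by (simp add: add_eq_0_iff2)
  qed
  then show "\<bar>u$1\<bar> \<le> 1 \<and> u$1 \<noteq> - 1"
    using component_le_norm_cart[of u 1] u(1) by simp
qed

text \<open>With \<open>t = arccos (u$1)\<close> the series may be integrated term by term by
  absolute summability, and only the Chebyshev averages of index 0 and 2 are nonzero.\<close>

lemma has_bochner_integral_sphere_cos_series:
  fixes f :: "real \<Rightarrow> real"
  assumes [measurable]: "f \<in> borel_measurable borel"
    and c: "summable (\<lambda>n. \<bar>c n\<bar>)"
    and f: "\<And>t. (\<lambda>n. c n * cos (real n * t)) sums f (cos t)"
  shows "has_bochner_integral sphere_haar (\<lambda>u. f (u$1)) (c 0 - c 2 / 2)"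
proof -
  \<comment> \<open>Writing the cosine as a polynomial in \<open>u$1\<close> makes every term
    integrable and gives its average at once.\<close>
  define g where "g n u = c n * poly (chebT n) (u$1)" for n and u :: quat
  have g_int: "integrable sphere_haar (g n)" for n
    unfolding g_def by (intro integrable_mult_right integrable_sphere_poly)
  have g_cos: "g n u = c n * cos (real n * arccos (u$1))" if "\<bar>u$1\<bar> \<le> 1" for n u
    using that cheb_cos[of n "arccos (u$1)"] by (simp add: g_def cos_arccos_abs)
  have g_le: "\<bar>g n u\<bar> \<le> \<bar>c n\<bar>" if "\<bar>u$1\<bar> \<le> 1" for n u
    unfolding g_cos[OF that] by (simp add: abs_mult mult_left_le)
  have summ_AE: "AE u in sphere_haar. summable (\<lambda>n. norm (g n u))"
    using AE_sphere_haar_component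
    by eventually_elim (rule summable_comparison_test_ev[OF _ c], auto intro!: always_eventually g_le)
  have summ: "summable (\<lambda>n. sphere.expectation (\<lambda>u. norm (g n u)))"
  proof (rule summable_comparison_test_ev[OF always_eventually c], rule allI)
    fix n
    have "sphere.expectation (\<lambda>u. norm (g n u)) \<le> sphere.expectation (\<lambda>u. \<bar>c n\<bar>)"
      using AE_sphere_haar_component
      by (intro integral_mono_AE integrable_norm g_int) (auto intro: g_le)
    then show "norm (sphere.expectation (\<lambda>u. norm (g n u))) \<le> \<bar>c n\<bar>"
      using sphere.prob_space by (simp add: integral_nonneg_AE)
  qed
  have eq: "AE u in sphere_haar. (\<Sum>n. g n u) = f (u$1)"
    using AE_sphere_haar_component
  proof eventually_elim
    fix u :: quat assume u: "\<bar>u$1\<bar> \<le> 1 \<and> u$1 \<noteq> - 1"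
    then show "(\<Sum>n. g n u) = f (u$1)"
      using f[of "arccos (u$1)"] by (simp add: g_cos cos_arccos_abs sums_iff)
  qed
  have suminf_int: "integrable sphere_haar (\<lambda>u. \<Sum>n. g n u)"
    by (rule integrable_suminf[OF g_int summ_AE summ])
  have "(\<lambda>n. sphere.expectation (g n)) sums sphere.expectation (\<lambda>u. \<Sum>n. g n u)"
    by (rule sums_integral[OF g_int summ_AE summ])
  moreover have "sphere.expectation (g n) = c n * (if n = 0 then 1 else if n = 2 then - 1 / 2 else 0)"
    for n unfolding g_def by (simp flip: sphere_chebT add: sphere_poly_def)
  moreover have "(\<lambda>n. c n * (if n = 0 then 1 else if n = 2 then - 1 / 2 else 0)) sums
      (\<Sum>n\<in>{0, 2}. c n * (if n = 0 then 1 else if n = 2 then - 1 / 2 else 0))"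
    by (rule sums_finite) auto
  ultimately have "sphere.expectation (\<lambda>u. \<Sum>n. g n u) = c 0 - c 2 / 2"
    using sums_unique2 by fastforce
  then have "has_bochner_integral sphere_haar (\<lambda>u. \<Sum>n. g n u) (c 0 - c 2 / 2)"
    using suminf_int by (simp add: has_bochner_integral_iff)
  then show ?thesis
    by (rule has_bochner_integral_cong_AE[THEN iffD1, rotated -1])
       (use eq borel_measurable_integrable[OF suminf_int] in auto)
qed

section \<open>The logarithmic kernel and the Poisson kernel\<close>

lemma cmod_one_plus_cis: "(cmod (1 + of_real r * cis t))\<^sup>2 = 1 + 2 * r * cos t + r\<^sup>2"
  unfolding cmod_power2
  by (simp add: power2_sum power_mult_distrib sin_squared_eq algebra_simps)

text \<open>Half the integrand is the real part of \<open>ln (1 + z)\<close> at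
  \<open>z = r * cis t\<close>, whose power series has the required cosine form.\<close>

lemma sphere_ln_lt_1:
  assumes r: "0 \<le> r" "r < 1"
  shows "has_bochner_integral sphere_haar (\<lambda>u. ln (1 + 2 * r * u$1 + r\<^sup>2)) (r\<^sup>2 / 2)"
proof -
  \<comment> \<open>Division by zero gives \<open>c 0 = 0\<close>, in accordance with the missing
    constant term; \<open>c 2 = - r^2 / 2\<close> supplies the value.\<close>
  define c where "c n = (-1) ^ Suc n / real n * r ^ n" for n
  have "has_bochner_integral sphere_haar (\<lambda>u. ln (1 + 2 * r * u$1 + r\<^sup>2) / 2) (c 0 - c 2 / 2)"
  proof (rule has_bochner_integral_sphere_cos_series)
    show "(\<lambda>x. ln (1 + 2 * r * x + r\<^sup>2) / 2) \<in> borel_measurable borel" by measurable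
    show "summable (\<lambda>n. \<bar>c n\<bar>)"
    proof (rule summable_comparison_test_ev[OF always_eventually], rule allI)
      show "norm \<bar>c n\<bar> \<le> r ^ n" for n
        using r by (cases n) (auto simp: c_def abs_mult power_abs field_simps)
      show "summable (\<lambda>n. r ^ n)" using r by (simp add: summable_geometric)
    qed
    fix t
    define z where "z = of_real r * cis t"
    have "cmod z < 1" using r by (simp add: z_def norm_mult)
    then have "1 + z \<noteq> 0"
      by (metis add_eq_0_iff2 norm_minus_cancel norm_one order_less_irrefl)
    have "(\<lambda>n. Re ((-1) ^ Suc n / of_nat n * z ^ n)) sums Re (ln (1 + z))"
      by (rule sums_Re[OF Ln_series]) fact
    moreover have "Re ((-1) ^ Suc n / of_nat n * z ^ n) = c n * cos (real n * t)" for n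
    proof -
      have "(-1) ^ Suc n / of_nat n * z ^ n = of_real (c n) * cis (real n * t)"
        by (simp add: c_def z_def power_mult_distrib Complex.DeMoivre)
      then show ?thesis by simp
    qed
    moreover have "Re (ln (1 + z)) = ln (1 + 2 * r * cos t + r\<^sup>2) / 2"
    proof -
      have "ln ((cmod (1 + z))\<^sup>2) = 2 * ln (cmod (1 + z))"
        using \<open>1 + z \<noteq> 0\<close> by (simp add: ln_realpow)
      then show ?thesis
        using \<open>1 + z \<noteq> 0\<close> by (simp add: z_def cmod_one_plus_cis)
    qed
    ultimately show "(\<lambda>n. c n * cos (real n * t)) sums (ln (1 + 2 * r * cos t + r\<^sup>2) / 2)"
      by simp
  qed
  then have "has_bochner_integral sphere_haar (\<lambda>u. 2 * (ln (1 + 2 * r * u$1 + r\<^sup>2) / 2)) (2 * (c 0 - c 2 / 2))"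
    by (rule has_bochner_integral_mult_right)
  then show ?thesis by (simp add: c_def)
qed

text \<open>Multiplied by \<open>1 - r^2\<close>, the integrand is the Poisson kernel, the real part
  of \<open>(1 - z) / (1 + z) = 2 / (1 + z) - 1\<close>. Its coefficients give the average
  \<open>1 - r^2\<close>, and this factor cancels.\<close>

lemma sphere_inverse_kernel:
  assumes r: "0 \<le> r" "r < 1"
  shows "has_bochner_integral sphere_haar (\<lambda>u. 1 / (1 + 2 * r * u$1 + r\<^sup>2)) 1"
proof -
  define c where "c n = 2 * (- r) ^ n - (if n = 0 then 1 else 0)" for n :: nat
  have "has_bochner_integral sphere_haar (\<lambda>u. (1 - r\<^sup>2) / (1 + 2 * r * u$1 + r\<^sup>2)) (c 0 - c 2 / 2)"
  proof (rule has_bochner_integral_sphere_cos_series)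
    show "(\<lambda>x. (1 - r\<^sup>2) / (1 + 2 * r * x + r\<^sup>2)) \<in> borel_measurable borel" by measurable
    show "summable (\<lambda>n. \<bar>c n\<bar>)"
    proof (rule summable_comparison_test_ev[OF always_eventually], rule allI)
      show "norm \<bar>c n\<bar> \<le> 2 * r ^ n" for n
        using r by (auto simp: c_def abs_mult power_abs)
      show "summable (\<lambda>n. 2 * r ^ n)" using r by (simp add: summable_geometric summable_mult)
    qed
    fix t
    define z where "z = of_real r * cis t"
    have "cmod z < 1" using r by (simp add: z_def norm_mult)
    then have nz: "1 + z \<noteq> 0"
      by (metis add_eq_0_iff2 norm_minus_cancel norm_one order_less_irrefl)
    have "(\<lambda>n. (- z) ^ n) sums (1 / (1 - (- z)))"
      by (rule geometric_sums) (use \<open>cmod z < 1\<close> in simp)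
    then have "(\<lambda>n. 2 * (- z) ^ n - (if n = 0 then 1 else 0)) sums (2 * (1 / (1 - (- z))) - 1)"
      by (intro sums_diff sums_mult) (use sums_single[of 0 "\<lambda>_. 1::complex"] in simp_all)
    then have "(\<lambda>n. Re (2 * (- z) ^ n - (if n = 0 then 1 else 0))) sums Re (2 * (1 / (1 - (- z))) - 1)"
      by (rule sums_Re)
    moreover have "Re (2 * (- z) ^ n - (if n = 0 then 1 else 0)) = c n * cos (real n * t)" for n
    proof -
      have "2 * (- z) ^ n - (if n = 0 then 1 else 0) = of_real (c n) * cis (real n * t)"
        by (simp add: c_def z_def power_mult_distrib Complex.DeMoivre flip: mult_minus_left of_real_minus)
      then show ?thesis by simp
    qed
    moreover have "Re (2 * (1 / (1 - (- z))) - 1) = (1 - r\<^sup>2) / (1 + 2 * r * cos t + r\<^sup>2)"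
    proof -
      have "2 * (1 / (1 - (- z))) - 1 = (1 - z) / (1 + z)"
        using nz by (simp add: field_simps)
      then have "Re (2 * (1 / (1 - (- z))) - 1) = (Re (1 - z) * Re (1 + z) + Im (1 - z) * Im (1 + z)) / (cmod (1 + z))\<^sup>2"
        by (simp only: Re_divide cmod_power2)
      also have "Re (1 - z) * Re (1 + z) + Im (1 - z) * Im (1 + z) = 1 - ((r * cos t)\<^sup>2 + (r * sin t)\<^sup>2)"
        by (simp add: z_def power2_eq_square algebra_simps)
      also have "(r * cos t)\<^sup>2 + (r * sin t)\<^sup>2 = r\<^sup>2"
        by (simp add: power_mult_distrib sin_squared_eq algebra_simps)
      finally show ?thesis by (simp add: z_def cmod_one_plus_cis)
    qed
    ultimately show "(\<lambda>n. c n * cos (real n * t)) sums ((1 - r\<^sup>2) / (1 + 2 * r * cos t + r\<^sup>2))"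
      by simp
  qed
  then have "has_bochner_integral sphere_haar
      (\<lambda>u. inverse (1 - r\<^sup>2) * ((1 - r\<^sup>2) / (1 + 2 * r * u$1 + r\<^sup>2))) (inverse (1 - r\<^sup>2) * (c 0 - c 2 / 2))"
    by (rule has_bochner_integral_mult_right)
  moreover have "r\<^sup>2 < 1" using r by (simp add: power_less_one_iff)
  ultimately show ?thesis by (simp add: c_def field_simps)
qed

lemma one_plus_cross_pos:
  fixes r x :: real
  assumes "0 \<le> r" "r \<le> 1" "\<bar>x\<bar> \<le> 1" "x \<noteq> -1"
  shows "1 + 2 * r * x + r\<^sup>2 > 0"
proof (cases "r = 0")
  case False
  \<comment> \<open>The expression is \<open>(1 - r)^2 + 2 * r * (1 + x)\<close>.\<close>
  have "0 < 1 + x" "0 < 2 * r" using assms False by linarith+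
  then have "0 < 2 * r * (1 + x)" by simp
  then have "0 < (1 - r)\<^sup>2 + 2 * r * (1 + x)"
    by (rule add_nonneg_pos[OF zero_le_power2])
  then show ?thesis by (simp add: power2_eq_square algebra_simps)
qed simp

text \<open>At \<open>r = 1\<close> the logarithm is unbounded. Since \<open>1 / r + r\<close> decreases on \<open>(0, 1]\<close>, the
  normalised integrand \<open>ln ((1 + 2rx + r\<^sup>2) / r)\<close> is monotone in \<open>r\<close>.\<close>

lemma sphere_ln_1: "has_bochner_integral sphere_haar (\<lambda>u. ln (2 + 2 * u$1)) (1 / 2)"
proof -
  define r where "r n = real (Suc n) / real (Suc (Suc n))" for n
  have r: "0 < r n" "r n < 1" for n by (simp_all add: r_def)
  have r_mono: "r m \<le> r n" if "m \<le> n" for m n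
    using that by (simp add: r_def field_simps)
  have r_lim: "r \<longlonglongrightarrow> 1"
    unfolding r_def using LIMSEQ_Suc[OF LIMSEQ_n_over_Suc_n] by simp
  \<comment> \<open>The sign makes the sequence increasing in \<open>n\<close>, as monotone
    convergence demands; the extra \<open>ln (r n)\<close> tends to 0.\<close>
  define f where "f n u = - (ln (1 + 2 * r n * u$1 + (r n)\<^sup>2) - ln (r n))" for n and u :: quat
  have f_eq: "f n u = - ln (1 / r n + r n + 2 * u$1)" if u: "\<bar>u$1\<bar> \<le> 1" "u$1 \<noteq> - 1" for n u
  proof -
    have "1 / r n + r n + 2 * u$1 = (1 + 2 * r n * u$1 + (r n)\<^sup>2) / r n"
      using r(1)[of n] by (simp add: field_simps power2_eq_square)
    then show ?thesis
      using one_plus_cross_pos[of "r n" "u$1"] u r[of n] by (simp add: f_def ln_div)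
  qed
  have f_int: "has_bochner_integral sphere_haar (f n) (- ((r n)\<^sup>2 / 2 - ln (r n)))" for n
  proof -
    have "has_bochner_integral sphere_haar (\<lambda>u. ln (r n)) (ln (r n))"
      using sphere.prob_space by (simp add: has_bochner_integral_iff)
    then show ?thesis unfolding f_def
      using r[of n] by (intro has_bochner_integral_minus has_bochner_integral_diff sphere_ln_lt_1) auto
  qed
  have "has_bochner_integral sphere_haar (\<lambda>u. - ln (2 + 2 * u$1)) (- (1 / 2))"
  proof (rule has_bochner_integral_monotone_convergence)
    show "integrable sphere_haar (f n)" for n using f_int by (simp add: has_bochner_integral_iff)
    show "(\<lambda>u. - ln (2 + 2 * u$1)) \<in> borel_measurable sphere_haar" by measurable
    have "(\<lambda>n. - ((r n)\<^sup>2 / 2 - ln (r n))) \<longlonglongrightarrow> - (1\<^sup>2 / 2 - ln 1)"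
      by (intro tendsto_intros r_lim) simp_all
    then show "(\<lambda>n. sphere.expectation (f n)) \<longlonglongrightarrow> - (1 / 2)"
      using f_int by (simp add: has_bochner_integral_iff)
    show "AE u in sphere_haar. mono (\<lambda>n. f n u)"
      using AE_sphere_haar_component
    proof eventually_elim
      fix u :: quat assume u: "\<bar>u$1\<bar> \<le> 1 \<and> u$1 \<noteq> - 1"
      have pos: "1 / r n + r n + 2 * u$1 > 0" for n
      proof -
        have "1 / r n + r n + 2 * u$1 = (1 + 2 * r n * u$1 + (r n)\<^sup>2) / r n"
          using r(1)[of n] by (simp add: field_simps power2_eq_square)
        then show ?thesis using one_plus_cross_pos[of "r n" "u$1"] u r[of n] by simp
      qed
      show "mono (\<lambda>n. f n u)"
      proof (rule monoI)
        fix m n :: nat assume "m \<le> n"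
        have "1 / r m + r m - (1 / r n + r n) = (r n - r m) * (1 - r m * r n) / (r m * r n)"
          using r(1)[of m] r(1)[of n] by (simp add: field_simps)
        moreover have "\<dots> \<ge> 0"
          using r[of m] r[of n] r_mono[OF \<open>m \<le> n\<close>]
          by (intro divide_nonneg_pos mult_nonneg_nonneg) (auto intro: mult_le_one)
        ultimately show "f m u \<le> f n u"
          using u pos[of m] pos[of n] by (simp add: f_eq)
      qed
    qed
    show "AE u in sphere_haar. (\<lambda>n. f n u) \<longlonglongrightarrow> - ln (2 + 2 * u$1)"
      using AE_sphere_haar_component
    proof eventually_elim
      fix u :: quat assume u: "\<bar>u$1\<bar> \<le> 1 \<and> u$1 \<noteq> - 1"
      have "(\<lambda>n. - ln (1 / r n + r n + 2 * u$1)) \<longlonglongrightarrow> - ln (1 / 1 + 1 + 2 * u$1)"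
        using u by (intro tendsto_intros r_lim) auto
      then show "(\<lambda>n. f n u) \<longlonglongrightarrow> - ln (2 + 2 * u$1)" using u by (simp add: f_eq)
    qed
  qed
  from has_bochner_integral_minus[OF this] show ?thesis by simp
qed

lemma sphere_ln:
  assumes r: "0 \<le> r" "r \<le> 1"
  shows "has_bochner_integral sphere_haar (\<lambda>u. ln (1 + 2 * r * u$1 + r\<^sup>2)) (r\<^sup>2 / 2)"
  using sphere_ln_lt_1[of r] sphere_ln_1 r by (cases "r = 1") auto

lemma sphere_ln_scaled:
  assumes "0 \<le> B" "B \<le> A" "0 < A"
  shows "has_bochner_integral sphere_haar (\<lambda>u. ln (A\<^sup>2 + B\<^sup>2 + 2 * (A * B * u$1)))
    (2 * ln A + B\<^sup>2 / (2 * A\<^sup>2))"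
proof -
  define r where "r = B / A"
  have r: "0 \<le> r" "r \<le> 1" using assms by (auto simp: r_def)
  have "has_bochner_integral sphere_haar (\<lambda>u. 2 * ln A) (2 * ln A)"
    using sphere.prob_space by (simp add: has_bochner_integral_iff)
  from has_bochner_integral_add[OF this sphere_ln[OF r]]
  have "has_bochner_integral sphere_haar (\<lambda>u. 2 * ln A + ln (1 + 2 * r * u$1 + r\<^sup>2)) (2 * ln A + r\<^sup>2 / 2)" .
  moreover have "r\<^sup>2 / 2 = B\<^sup>2 / (2 * A\<^sup>2)" by (simp add: r_def power_divide)
  moreover have "AE u in sphere_haar. 2 * ln A + ln (1 + 2 * r * u$1 + r\<^sup>2) = ln (A\<^sup>2 + B\<^sup>2 + 2 * (A * B * u$1))"
    using AE_sphere_haar_component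
  proof eventually_elim
    fix u :: quat assume u: "\<bar>u$1\<bar> \<le> 1 \<and> u$1 \<noteq> - 1"
    \<comment> \<open>Factoring out \<open>A^2\<close> and putting \<open>r = B / A\<close> reduces
      to the normalised kernel. Splitting the logarithm needs a positive second factor, hence the
      almost everywhere argument.\<close>
    have "A\<^sup>2 + B\<^sup>2 + 2 * (A * B * u$1) = A\<^sup>2 * (1 + 2 * r * u$1 + r\<^sup>2)"
      using assms by (simp add: r_def field_simps power2_eq_square)
    then show "2 * ln A + ln (1 + 2 * r * u$1 + r\<^sup>2) = ln (A\<^sup>2 + B\<^sup>2 + 2 * (A * B * u$1))"
      using one_plus_cross_pos[OF r, of "u$1"] u assms by (simp add: ln_mult ln_realpow)
  qed
  ultimately show ?thesis
    by (subst has_bochner_integral_cong_AE[symmetric]) auto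
qed

subsection \<open>Quaternionic averages\<close>

definition qconj :: "quat \<Rightarrow> quat" where
  "qconj q = (\<chi> n. if n = 1 then q$1 else - q$n)"

lemma inner_quat: "u \<bullet> v = u$1 * v$1 + u$2 * v$2 + u$3 * v$3 + u$4 * v$4" for u v :: quat
  by (simp add: inner_vec_def sum_4)

lemma norm_qconj: "norm (qconj q) = norm q"
  unfolding norm_eq_sqrt_inner inner_quat by (simp add: qconj_def)

text \<open>Euler's four-square identity.\<close>

lemma norm_qmult: "norm (qmult p q) = norm p * norm q"
  unfolding norm_eq_sqrt_inner real_sqrt_mult[symmetric] inner_quat
  by (simp add: qmult_def algebra_simps)

text \<open>The adjoint of left multiplication by \<open>q\<close> is left multiplication by its
  conjugate.\<close>

lemma inner_qmult: "qmult q u \<bullet> p = qmult (qconj q) p \<bullet> u"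
  unfolding inner_quat by (simp add: qmult_def qconj_def algebra_simps)

text \<open>For unit \<open>u\<close> the dependence on \<open>u\<close> becomes a single linear
  form, which is what rotation invariance can handle.\<close>

lemma norm_qmult_add:
  "(norm (qmult q u + p))\<^sup>2 = (norm q * norm u)\<^sup>2 + (norm p)\<^sup>2 + 2 * (qmult (qconj q) p \<bullet> u)"
proof -
  have "(norm (qmult q u + p))\<^sup>2 = (norm (qmult q u))\<^sup>2 + (norm p)\<^sup>2 + 2 * (qmult q u \<bullet> p)"
    unfolding power2_norm_eq_inner by (simp add: inner_add inner_commute)
  then show ?thesis by (simp only: norm_qmult inner_qmult[of q u p])
qed

lemma qmult_measurable [measurable]:
  assumes "f \<in> borel_measurable M"
  shows "(\<lambda>x. qmult a (f x)) \<in> borel_measurable M"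
proof -
  have "linear (qmult a)"
    by (rule linearI) (simp_all add: vec_eq_iff qmult_def algebra_simps)
  then have "continuous_on UNIV (qmult a)"
    by (intro linear_continuous_on) (simp add: linear_conv_bounded_linear)
  then show ?thesis
    using borel_measurable_continuous_on assms by blast
qed

text \<open>The vector of that linear form has norm \<open>norm q * norm p\<close>, so the form may
  be replaced by this multiple of \<open>u$1\<close>.\<close>

lemma has_bochner_integral_sphere_norm_qmult_add:
  fixes g :: "real \<Rightarrow> real"
  assumes [measurable]: "g \<in> borel_measurable borel"
    and "has_bochner_integral sphere_haar (\<lambda>u. g ((norm q)\<^sup>2 + (norm p)\<^sup>2 + 2 * (norm q * norm p * u$1))) v"
  shows "has_bochner_integral sphere_haar (\<lambda>u. g ((norm (qmult q u + p))\<^sup>2)) v"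
proof -
  have "has_bochner_integral sphere_haar
      (\<lambda>u. g ((norm q)\<^sup>2 + (norm p)\<^sup>2 + 2 * (qmult (qconj q) p \<bullet> u))) v"
    by (subst has_bochner_integral_sphere_inner[where g = "\<lambda>t. g ((norm q)\<^sup>2 + (norm p)\<^sup>2 + 2 * t)"])
       (use assms(2) in \<open>simp_all add: norm_qmult norm_qconj\<close>)
  moreover have "AE u in sphere_haar. g ((norm q)\<^sup>2 + (norm p)\<^sup>2 + 2 * (qmult (qconj q) p \<bullet> u))
      = g ((norm (qmult q u + p))\<^sup>2)"
    using AE_sphere_haar_norm by eventually_elim (simp add: norm_qmult_add)
  ultimately show ?thesis
    by (subst has_bochner_integral_cong_AE[symmetric]) auto
qed

lemma sphere_ln_norm:
  "has_bochner_integral sphere_haar (\<lambda>u. ln (norm (qmult q u + p)))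
    (ln (max (norm q) (norm p)) + (min (norm q) (norm p))\<^sup>2 / (4 * (max (norm q) (norm p))\<^sup>2))"
proof (cases "q = 0 \<and> p = 0")
  \<comment> \<open>Both sides are 0 here, by the conventions \<open>ln 0 = 0\<close> and
    \<open>x / 0 = 0\<close>.\<close>
  case True
  then have "norm (qmult q u + p) = 0" for u by (simp add: norm_qmult)
  then show ?thesis using True by (simp add: has_bochner_integral_zero)
next
  case False
  let ?M = "max (norm q) (norm p)" and ?m = "min (norm q) (norm p)"
  have "0 < ?M" using False by (auto simp: max_def)
  then have "has_bochner_integral sphere_haar (\<lambda>u. ln (?M\<^sup>2 + ?m\<^sup>2 + 2 * (?M * ?m * u$1)))
    (2 * ln ?M + ?m\<^sup>2 / (2 * ?M\<^sup>2))"
    by (intro sphere_ln_scaled) auto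
  then have "has_bochner_integral sphere_haar
      (\<lambda>u. ln ((norm q)\<^sup>2 + (norm p)\<^sup>2 + 2 * (norm q * norm p * u$1))) (2 * ln ?M + ?m\<^sup>2 / (2 * ?M\<^sup>2))"
    by (cases "norm q \<le> norm p") (simp_all add: max_def min_def add_ac mult_ac)
  from has_bochner_integral_sphere_norm_qmult_add[OF _ this]
  have "has_bochner_integral sphere_haar (\<lambda>u. ln ((norm (qmult q u + p))\<^sup>2))
      (2 * ln ?M + ?m\<^sup>2 / (2 * ?M\<^sup>2))" by simp
  from has_bochner_integral_mult_right[OF this, of "1 / 2"]
  have "has_bochner_integral sphere_haar (\<lambda>u. 1 / 2 * ln ((norm (qmult q u + p))\<^sup>2))
      (1 / 2 * (2 * ln ?M + ?m\<^sup>2 / (2 * ?M\<^sup>2)))" .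
  moreover have "1 / 2 * ln ((norm v)\<^sup>2) = ln (norm v)" for v :: quat
    by (cases "v = 0") (simp_all add: ln_realpow)
  moreover have "1 / 2 * (2 * ln ?M + ?m\<^sup>2 / (2 * ?M\<^sup>2)) = ln ?M + ?m\<^sup>2 / (4 * ?M\<^sup>2)"
    by (simp add: algebra_simps)
  ultimately show ?thesis by (simp only:)
qed

text \<open>The cross term is odd in \<open>u\<close> and averages to 0.\<close>

lemma sphere_norm_square:
  "has_bochner_integral sphere_haar (\<lambda>u. (norm (qmult q u + p))\<^sup>2) ((norm q)\<^sup>2 + (norm p)\<^sup>2)"
proof (rule has_bochner_integral_sphere_norm_qmult_add[where g = "\<lambda>t. t"])
  have const: "has_bochner_integral sphere_haar (\<lambda>u. (norm q)\<^sup>2 + (norm p)\<^sup>2) ((norm q)\<^sup>2 + (norm p)\<^sup>2)"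
    using sphere.prob_space by (simp add: has_bochner_integral_iff)
  have "has_bochner_integral sphere_haar (\<lambda>u. u$1) 0"
    using sphere_odd_moment[of 1] integrable_sphere_poly[of "[:0, 1:]"]
    by (simp add: has_bochner_integral_iff)
  from has_bochner_integral_add[OF const has_bochner_integral_mult_right[OF this, of "2 * (norm q * norm p)"]]
  show "has_bochner_integral sphere_haar
      (\<lambda>u. (norm q)\<^sup>2 + (norm p)\<^sup>2 + 2 * (norm q * norm p * u$1)) ((norm q)\<^sup>2 + (norm p)\<^sup>2)"
    by (simp add: mult_ac)
qed simp

lemma sphere_inverse_norm_square:
  assumes "norm q < norm p"
  shows "has_bochner_integral sphere_haar (\<lambda>u. 1 / (norm (qmult q u + p))\<^sup>2) (1 / (norm p)\<^sup>2)"
proof (rule has_bochner_integral_sphere_norm_qmult_add[where g = "\<lambda>t. 1 / t"])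
  have p: "0 < norm p" using assms norm_ge_zero[of q] by linarith
  define r where "r = norm q / norm p"
  have r: "0 \<le> r" "r < 1" using assms p by (auto simp: r_def)
  have "(norm q)\<^sup>2 + (norm p)\<^sup>2 + 2 * (norm q * norm p * x) = (norm p)\<^sup>2 * (1 + 2 * r * x + r\<^sup>2)" for x
    using p by (simp add: r_def field_simps power2_eq_square)
  then show "has_bochner_integral sphere_haar
      (\<lambda>u. 1 / ((norm q)\<^sup>2 + (norm p)\<^sup>2 + 2 * (norm q * norm p * u$1))) (1 / (norm p)\<^sup>2)"
    using has_bochner_integral_mult_right[OF sphere_inverse_kernel[OF r], of "1 / (norm p)\<^sup>2"] by simp
qed simp

section \<open>Iterated averages over the torus\<close>

text \<open>The logarithm is unbounded only from below. A bound \<open>K\<close> from above makes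
  \<open>K - f\<close> nonnegative almost everywhere, so its absolute value has the inner integral
  \<open>K - h x\<close>, and integrability of \<open>h\<close> yields that of \<open>f\<close> on
  the product.\<close>

lemma torus_has_bochner_integral:
  fixes f :: "quat \<times> quat \<Rightarrow> real"
  assumes [measurable]: "f \<in> borel_measurable (borel \<Otimes>\<^sub>M borel)"
    and ub: "\<And>x y. norm x = 1 \<Longrightarrow> norm y = 1 \<Longrightarrow> f (x, y) \<le> K"
    and inner: "\<And>x. norm x = 1 \<Longrightarrow> has_bochner_integral sphere_haar (\<lambda>y. f (x, y)) (h x)"
    and outer: "has_bochner_integral sphere_haar h v"
  shows "has_bochner_integral torus_haar f v"
proof -
  interpret pair_prob_space sphere_haar sphere_haar ..
  have [measurable]: "h \<in> borel_measurable borel"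
    using borel_measurable_has_bochner_integral[OF outer] by simp
  have const: "has_bochner_integral sphere_haar (\<lambda>u. K) K"
    using sphere.prob_space by (simp add: has_bochner_integral_iff)
  have g: "has_bochner_integral sphere_haar (\<lambda>y. norm (K - f (x, y))) (K - h x)" if x: "norm x = 1" for x
  proof (rule has_bochner_integral_cong_AE[THEN iffD1, rotated -1])
    show "has_bochner_integral sphere_haar (\<lambda>y. K - f (x, y)) (K - h x)"
      by (rule has_bochner_integral_diff[OF const inner[OF x]])
    show "AE y in sphere_haar. K - f (x, y) = norm (K - f (x, y))"
      using AE_sphere_haar_norm by eventually_elim (simp add: ub x)
  qed measurable
  have "integrable (sphere_haar \<Otimes>\<^sub>M sphere_haar) (\<lambda>z. K - f z)"
  proof (rule Fubini_integrable)
    have "integrable sphere_haar (\<lambda>x. K - h x)"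
      using outer by (simp add: has_bochner_integral_iff)
    then show "integrable sphere_haar (\<lambda>x. \<integral>y. norm (K - f (x, y)) \<partial>sphere_haar)"
    proof (rule integrable_cong_AE_imp)
      show "AE x in sphere_haar. K - h x = (\<integral>y. norm (K - f (x, y)) \<partial>sphere_haar)"
        using AE_sphere_haar_norm
        by eventually_elim (use g in \<open>simp add: has_bochner_integral_iff\<close>)
    qed measurable
    show "AE x in sphere_haar. integrable sphere_haar (\<lambda>y. K - f (x, y))"
      using AE_sphere_haar_norm
      by eventually_elim (use inner in \<open>simp add: has_bochner_integral_iff\<close>)
  qed measurable
  then have "integrable (sphere_haar \<Otimes>\<^sub>M sphere_haar) (\<lambda>z. K - (K - f z))"
    by (rule Bochner_Integration.integrable_diff[OF P.integrable_const])
  then have int: "integrable (sphere_haar \<Otimes>\<^sub>M sphere_haar) f" by simp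
  have "integral\<^sup>L (sphere_haar \<Otimes>\<^sub>M sphere_haar) f = (\<integral>x. (\<integral>y. f (x, y) \<partial>sphere_haar) \<partial>sphere_haar)"
    by (rule integral_fst'[OF int, symmetric])
  also have "\<dots> = (\<integral>x. h x \<partial>sphere_haar)"
  proof (rule integral_cong_AE)
    show "AE x in sphere_haar. (\<integral>y. f (x, y) \<partial>sphere_haar) = h x"
      using AE_sphere_haar_norm
      by eventually_elim (use inner in \<open>simp add: has_bochner_integral_iff\<close>)
  qed measurable
  also have "\<dots> = v" using outer by (simp add: has_bochner_integral_iff)
  finally show ?thesis using int by (simp add: has_bochner_integral_iff torus_haar_def)
qed

text \<open>Both factors carry the same measure; this reduces a dominant \<open>a\<close> to a
  dominant \<open>b\<close>.\<close>

lemma torus_haar_swap: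
  assumes "has_bochner_integral torus_haar (\<lambda>(x, y). f (y, x)) v"
  shows "has_bochner_integral torus_haar f (v::real)"
proof -
  interpret pair_sigma_finite sphere_haar sphere_haar ..
  have int: "integrable (sphere_haar \<Otimes>\<^sub>M sphere_haar) f"
    using assms integrable_product_swap_iff[of f]
    by (simp add: has_bochner_integral_iff torus_haar_def)
  then show ?thesis
    using assms integral_product_swap[of f] 
    by (simp add: has_bochner_integral_iff torus_haar_def borel_measurable_integrable)
qed

text \<open>Supplies the upper bound for the Fubini argument, from \<open>ln t <= t - 1\<close>;
  where the argument vanishes, \<open>ln 0 = 0\<close> is still below it.\<close>

lemma ln_norm_le:
  assumes "norm x = 1" "norm y = 1"
  shows "ln (norm (qmult a x + qmult b y + c)) \<le> norm a + norm b + norm c"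
proof (cases "qmult a x + qmult b y + c = 0")
  case False
  then have "ln (norm (qmult a x + qmult b y + c)) \<le> norm (qmult a x + qmult b y + c) - 1"
    by (intro ln_le_minus_one) simp
  also have "\<dots> \<le> norm (qmult a x) + norm (qmult b y) + norm c"
    using norm_triangle_ineq[of "qmult a x + qmult b y" c] norm_triangle_ineq[of "qmult a x" "qmult b y"]
    by linarith
  finally show ?thesis using assms by (simp add: norm_qmult)
qed simp

lemma torus_ln_norm_dominant_coeff:
  assumes dom: "norm a + norm c \<le> norm b"
  shows "has_bochner_integral torus_haar (\<lambda>z. ln (norm (qmult a (fst z) + qmult b (snd z) + c)))
    (ln (norm b) + ((norm a)\<^sup>2 + (norm c)\<^sup>2) / (4 * (norm b)\<^sup>2))"
proof (rule torus_has_bochner_integral)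
  show "ln (norm (qmult a (fst (x, y)) + qmult b (snd (x, y)) + c)) \<le> norm a + norm b + norm c"
    if "norm x = 1" "norm y = 1" for x y
    using ln_norm_le[OF that] by simp
  show "has_bochner_integral sphere_haar
      (\<lambda>y. ln (norm (qmult a (fst (x, y)) + qmult b (snd (x, y)) + c)))
      (ln (norm b) + 1 / (4 * (norm b)\<^sup>2) * (norm (qmult a x + c))\<^sup>2)" if x: "norm x = 1" for x
  proof -
    \<comment> \<open>Dominance of \<open>b\<close> puts every unit \<open>x\<close> into the same
      branch of the maximum, so the inner average is affine in the squared norm of
      \<open>a x + c\<close>.\<close>
    have "norm (qmult a x + c) \<le> norm b"
      using norm_triangle_ineq[of "qmult a x" c] dom x by (simp add: norm_qmult)
    then show ?thesis
      using sphere_ln_norm[of b "qmult a x + c"] by (simp add: max_absorb1 min_absorb2 add_ac)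
  qed
  have const: "has_bochner_integral sphere_haar (\<lambda>u. ln (norm b)) (ln (norm b))"
    using sphere.prob_space by (simp add: has_bochner_integral_iff)
  show "has_bochner_integral sphere_haar
      (\<lambda>x. ln (norm b) + 1 / (4 * (norm b)\<^sup>2) * (norm (qmult a x + c))\<^sup>2)
      (ln (norm b) + ((norm a)\<^sup>2 + (norm c)\<^sup>2) / (4 * (norm b)\<^sup>2))"
    using has_bochner_integral_add[OF const
        has_bochner_integral_mult_right[OF sphere_norm_square[of a c], of "1 / (4 * (norm b)\<^sup>2)"]]
    by simp
qed measurable

lemma torus_ln_norm_dominant_const:
  assumes dom: "norm a + norm b \<le> norm c"
  shows "has_bochner_integral torus_haar (\<lambda>z. ln (norm (qmult a (fst z) + qmult b (snd z) + c)))
    (ln (norm c) + ((norm a)\<^sup>2 + (norm b)\<^sup>2) / (4 * (norm c)\<^sup>2))"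
proof (rule torus_has_bochner_integral)
  show "ln (norm (qmult a (fst (x, y)) + qmult b (snd (x, y)) + c)) \<le> norm a + norm b + norm c"
    if "norm x = 1" "norm y = 1" for x y
    using ln_norm_le[OF that] by simp
  show "has_bochner_integral sphere_haar
      (\<lambda>y. ln (norm (qmult a (fst (x, y)) + qmult b (snd (x, y)) + c)))
      (ln (norm (qmult a x + c)) + (norm b)\<^sup>2 / 4 * (1 / (norm (qmult a x + c))\<^sup>2))"
    if x: "norm x = 1" for x
  proof -
    have "norm c \<le> norm (qmult a x + c) + norm (qmult a x)"
      using norm_triangle_ineq4[of "qmult a x + c" "qmult a x"] by simp
    \<comment> \<open>The reverse triangle inequality fixes the other branch of the maximum for
      every unit \<open>x\<close>.\<close>
    then have "norm b \<le> norm (qmult a x + c)"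
      using dom x by (simp add: norm_qmult)
    then show ?thesis
      using sphere_ln_norm[of b "qmult a x + c"] by (simp add: max_absorb2 min_absorb1 add_ac)
  qed
  have "norm a \<le> norm c" using dom norm_ge_zero[of b] by linarith
  have "has_bochner_integral sphere_haar (\<lambda>x. (norm b)\<^sup>2 / 4 * (1 / (norm (qmult a x + c))\<^sup>2))
      ((norm b)\<^sup>2 / 4 * (1 / (norm c)\<^sup>2))"
  \<comment> \<open>The average of the inverse square is available for
    \<open>norm a < norm c\<close>, which follows from dominance if \<open>b\<close> is nonzero. For
    \<open>b = 0\<close> the norms may agree, but then the prefactor is 0.\<close>
  proof (cases "b = 0")
    case False
    then have "norm a < norm c" using dom by (smt (verit) zero_less_norm_iff)
    then show ?thesis by (intro has_bochner_integral_mult_right sphere_inverse_norm_square)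
  qed (simp add: has_bochner_integral_zero)
  from has_bochner_integral_add[OF sphere_ln_norm[of a c] this]
  show "has_bochner_integral sphere_haar
      (\<lambda>x. ln (norm (qmult a x + c)) + (norm b)\<^sup>2 / 4 * (1 / (norm (qmult a x + c))\<^sup>2))
      (ln (norm c) + ((norm a)\<^sup>2 + (norm b)\<^sup>2) / (4 * (norm c)\<^sup>2))"
    using \<open>norm a \<le> norm c\<close> by (simp add: max_absorb2 min_absorb1 add_divide_distrib add.assoc)
qed measurable

theorem theorem1p6:
  fixes a b c :: quat
  assumes "Max {norm a, norm b, norm c} > 0"
    and "Max {norm a, norm b, norm c} \<ge> norm a + norm b + norm c - Max {norm a, norm b, norm c}"
  shows "integrable torus_haar (\<lambda>z. ln (norm (qmult a (fst z) + qmult b (snd z) + c)))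
    \<and> mahler_H (\<lambda>x y. qmult a x + qmult b y + c)
      = ln (Max {norm a, norm b, norm c})
        + ((norm a)\<^sup>2 + (norm b)\<^sup>2 + (norm c)\<^sup>2) / (4 * (Max {norm a, norm b, norm c})\<^sup>2) - 1/4"
proof -
  define M where "M = Max {norm a, norm b, norm c}"
  have M: "M > 0" "M \<ge> norm a + norm b + norm c - M" using assms by (simp_all add: M_def)
  \<comment> \<open>Subtracting \<open>M^2\<close> in the numerator leaves the squares of the two
    other norms, a form common to all three cases; it produces the final
    \<open>- 1/4\<close>.\<close>
  have "has_bochner_integral torus_haar (\<lambda>z. ln (norm (qmult a (fst z) + qmult b (snd z) + c)))
      (ln M + ((norm a)\<^sup>2 + (norm b)\<^sup>2 + (norm c)\<^sup>2 - M\<^sup>2) / (4 * M\<^sup>2))"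
  proof -
    consider "M = norm a" | "M = norm b" | "M = norm c"
      unfolding M_def using Max_in[of "{norm a, norm b, norm c}"] by auto
    then show ?thesis
    proof cases
      \<comment> \<open>The roles of the two variables are exchanged, so that \<open>a\<close>
        multiplies the variable averaged first.\<close>
      case 1
      have "has_bochner_integral torus_haar (\<lambda>z. ln (norm (qmult b (fst z) + qmult a (snd z) + c)))
          (ln (norm a) + ((norm b)\<^sup>2 + (norm c)\<^sup>2) / (4 * (norm a)\<^sup>2))"
        using M 1 by (intro torus_ln_norm_dominant_coeff) auto
      also have "(\<lambda>z. ln (norm (qmult b (fst z) + qmult a (snd z) + c)))
          = (\<lambda>(x, y). ln (norm (qmult a (fst (y, x)) + qmult b (snd (y, x)) + c)))"
        by (simp add: fun_eq_iff add.commute)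
      finally show ?thesis
        unfolding 1 using torus_haar_swap[where f = "\<lambda>z. ln (norm (qmult a (fst z) + qmult b (snd z) + c))"]
        by simp
    next
      case 2
      have "has_bochner_integral torus_haar (\<lambda>z. ln (norm (qmult a (fst z) + qmult b (snd z) + c)))
          (ln (norm b) + ((norm a)\<^sup>2 + (norm c)\<^sup>2) / (4 * (norm b)\<^sup>2))"
        using M 2 by (intro torus_ln_norm_dominant_coeff) auto
      then show ?thesis unfolding 2 by simp
    next
      case 3
      have "has_bochner_integral torus_haar (\<lambda>z. ln (norm (qmult a (fst z) + qmult b (snd z) + c)))
          (ln (norm c) + ((norm a)\<^sup>2 + (norm b)\<^sup>2) / (4 * (norm c)\<^sup>2))"
        using M 3 by (intro torus_ln_norm_dominant_const) auto
      then show ?thesis unfolding 3 by simp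
    qed
  qed
  moreover have "ln M + (s - M\<^sup>2) / (4 * M\<^sup>2) = ln M + s / (4 * M\<^sup>2) - 1 / 4" for s
    using M(1) by (simp add: diff_divide_distrib)
  ultimately show ?thesis
    unfolding M_def[symmetric] mahler_H_def by (simp only: has_bochner_integral_iff simp_thms)
qed

end
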